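(* Let $(E,\pi,B)$ be a complex vector bundle with fibres of complex dimension $n$ and $g$ a Hermitian bundle metric on it such that, for every (resp. for some given) path $\gamma:J\to B$, the signature of $g$ at $\gamma(s)$ does not depend on $s\in J$. Along $\gamma$ let bases $\{e_i(s)\}$, $s\in J$, be chosen, in which $g$ has the Hermitian matrix $G(\gamma(s))$, with the first $p$ eigenvalues of $G(\gamma(s))$ positive and the remaining $q=n-p$ negative. Let $D(\gamma(s))$, $s\in J$, be fixed matrices such that $$\bigl(D(\gamma(s))\bigr)^{*}G^{T}(\gamma(s))D(\gamma(s))=G_{p,q}:=\mathrm{diag}(\underbrace{1,\dots,1}_{p},\underbrace{-1,\dots,-1}_{q}).$$ Then a ($\mathbb{C}$-)linear transport along paths is consistent with $g$ along every (resp. the given) path $\gamma$ if and only if, for every (resp. the given) path $\gamma$, some matrix function $F$ defining its matrix by $H(t,s;\gamma)=F^{-1}(t;\gamma)F(s;\gamma)$ has the form $$F(s;\gamma)=Y(\gamma)Z(s;\gamma)\bigl(D(\gamma(s))\bigr)^{-1},\qquad s\in J,$$ where $Y(\gamma)$ is a nondegenerate $n\times n$ matrix depending only on $\gamma$ and $Z(s;\gamma)$ is a pseudo-unitary matrix of type $(p,q)$, i.e. $\bigl(Z(s;\gamma)\bigr)^{*}G_{p,q}Z(s;\gamma)=G_{p,q}$.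
   Context: A path in $B$ is a (continuous) map $\gamma:J\to B$ with $J$ an arbitrary real interval. A Hermitian bundle metric $g$ assigns to each $x\in B$ a map $g_x:\pi^{-1}(x)\times\pi^{-1}(x)\to\mathbb{C}$ that is sesquilinear (linear in the first and conjugate-linear in the second argument), nondegenerate, and Hermitian, $g_x(u,v)=\overline{g_x(v,u)}$. Positive definiteness and regularity in $x$ are not assumed. Its signature at $x$ is $p(x)-q(x)$, with $p(x)$, $q(x)=n-p(x)$ the numbers of positive and negative eigenvalues of a matrix of $g_x$. A linear transport along paths $L$ assigns to each path $\gamma:J\to B$ and $s,t\in J$ a $\mathbb{C}$-linear map $L^\gamma_{s\to t}:\pi^{-1}(\gamma(s))\to\pi^{-1}(\gamma(t))$ with $L^\gamma_{t\to r}\circ L^\gamma_{s\to t}=L^\gamma_{s\to r}$ and $L^\gamma_{s\to s}=\mathrm{id}$ for all $r,s,t\in J$ (no regularity assumed). $L$ and $g$ are consistent along $\gamma$ if $g_{\gamma(s)}(u,v)=g_{\gamma(t)}(L^\gamma_{s\to t}u,L^\gamma_{s\to t}v)$ for all $s,t\in J$, $u,v\in\pi^{-1}(\gamma(s))$. In bases $\{e_i(s)\}$: $L^\gamma_{s\to t}e_j(s)=\sum_iH^{i}_{\;j}(t,s;\gamma)e_i(t)$, and $G(\gamma(s))=[g_{\gamma(s)}(e_i(s),e_j(s))]_{ij}$. Every linear transport has a matrix of the form $F^{-1}(t;\gamma)F(s;\gamma)$ with $F(s;\gamma)$ invertible, $F$ being defined up to $F(s;\gamma)\mapsto A(\gamma)F(s;\gamma)$,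 $A(\gamma)$ invertible. $T$ is transposition and $*$ is Hermitian conjugation (conjugate transpose) of matrices. *)

theory Defs
  imports
    "HOL-Analysis.Topology_Euclidean_Space"
    "HOL-Analysis.Function_Topology"
    "HOL-Analysis.Product_Topology"
    "Jordan_Normal_Form.VS_Connect"
    "Jordan_Normal_Form.Char_Poly"
    "Jordan_Normal_Form.Gauss_Jordan_Elimination"
    "Jordan_Normal_Form.Schur_Decomposition"
begin

section \<open>Complex vector bundles\<close>

text \<open>
  Every fibre is a module record over the field of complex numbers whose carrier is the preimage
  of a point. The model fibre is the space of tuples indexed by \<open>{..<n}\<close> with its product topology.
  The total space and the base are arbitrary topological spaces.
\<close>

abbreviation complex_coordinate_space :: "nat \<Rightarrow> (nat \<Rightarrow> complex) topology" where
  "complex_coordinate_space n \<equiv> product_topology (\<lambda>_. euclidean) {..<n}"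

definition local_trivialization ::
  "'e topology \<Rightarrow> ('e \<Rightarrow> 'b) \<Rightarrow> 'b topology \<Rightarrow> ('b \<Rightarrow> (complex, 'e) module) \<Rightarrow> nat \<Rightarrow>
    'b set \<Rightarrow> ('e \<Rightarrow> 'b \<times> (nat \<Rightarrow> complex)) \<Rightarrow> bool" where
  "local_trivialization E \<pi> B V n U \<phi> \<longleftrightarrow>
     homeomorphic_map (subtopology E {e \<in> topspace E. \<pi> e \<in> U})
       (prod_topology (subtopology B U) (complex_coordinate_space n)) \<phi> \<and>
     (\<forall>e \<in> topspace E. \<pi> e \<in> U \<longrightarrow> fst (\<phi> e) = \<pi> e) \<and>
     (\<forall>x \<in> U. \<forall>u \<in> carrier (V x). \<forall>v \<in> carrier (V x). \<forall>i < n.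
        snd (\<phi> (u \<oplus>\<^bsub>V x\<^esub> v)) i = snd (\<phi> u) i + snd (\<phi> v) i) \<and>
     (\<forall>x \<in> U. \<forall>c. \<forall>u \<in> carrier (V x). \<forall>i < n.
        snd (\<phi> (c \<odot>\<^bsub>V x\<^esub> u)) i = c * snd (\<phi> u) i)"

locale complex_vector_bundle =
  fixes E :: "'e topology"
    and \<pi> :: "'e \<Rightarrow> 'b"
    and B :: "'b topology"
    and V :: "'b \<Rightarrow> (complex, 'e) module"
    and n :: nat
  assumes continuous_projection: "continuous_map E B \<pi>"
    and surjective_projection: "\<pi> ` topspace E = topspace B"
    and fibre_carrier: "x \<in> topspace B \<Longrightarrow> carrier (V x) = {e \<in> topspace E. \<pi> e = x}"
    and fibre_vectorspace: "x \<in> topspace B \<Longrightarrow> vectorspace class_ring (V x)"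
    and fibre_fin_dim: "x \<in> topspace B \<Longrightarrow> vectorspace.fin_dim class_ring (V x)"
    and fibre_dim: "x \<in> topspace B \<Longrightarrow> vectorspace.dim class_ring (V x) = n"
    and locally_trivial:
      "x \<in> topspace B \<Longrightarrow> \<exists>U \<phi>. openin B U \<and> x \<in> U \<and> local_trivialization E \<pi> B V n U \<phi>"

definition ordered_basis :: "(complex, 'e) module \<Rightarrow> nat \<Rightarrow> (nat \<Rightarrow> 'e) \<Rightarrow> bool" where
  "ordered_basis W n b \<longleftrightarrow>
     inj_on b {..<n} \<and> vectorspace.basis class_ring W (b ` {..<n})"

text \<open>
  A path is a map with domain exactly \<open>J\<close>. Extensionality removes the irrelevant values of the
  total function outside \<open>J\<close>, so that a pair \<open>(J, \<gamma>)\<close> determines, and is determined by, one path.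
\<close>

definition path_in :: "'b topology \<Rightarrow> real set \<Rightarrow> (real \<Rightarrow> 'b) \<Rightarrow> bool" where
  "path_in B J \<gamma> \<longleftrightarrow>
     is_interval J \<and> J \<noteq> {} \<and> \<gamma> \<in> extensional J \<and> continuous_map (top_of_set J) B \<gamma>"


section \<open>Hermitian bundle metrics\<close>

definition hermitian_bundle_metric ::
  "'b topology \<Rightarrow> ('b \<Rightarrow> (complex, 'e) module) \<Rightarrow> ('b \<Rightarrow> 'e \<Rightarrow> 'e \<Rightarrow> complex) \<Rightarrow> bool" where
  "hermitian_bundle_metric B V g \<longleftrightarrow>
     (\<forall>x \<in> topspace B.
        (\<forall>u \<in> carrier (V x). \<forall>v \<in> carrier (V x). \<forall>w \<in> carrier (V x).
           g x (u \<oplus>\<^bsub>V x\<^esub> v) w = g x u w + g x v w \<and>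
           g x w (u \<oplus>\<^bsub>V x\<^esub> v) = g x w u + g x w v) \<and>
        (\<forall>c. \<forall>u \<in> carrier (V x). \<forall>v \<in> carrier (V x).
           g x (c \<odot>\<^bsub>V x\<^esub> u) v = c * g x u v \<and>
           g x u (c \<odot>\<^bsub>V x\<^esub> v) = cnj c * g x u v) \<and>
        (\<forall>u \<in> carrier (V x).
           (\<forall>v \<in> carrier (V x). g x u v = 0) \<longrightarrow> u = \<zero>\<^bsub>V x\<^esub>) \<and>
        (\<forall>u \<in> carrier (V x). \<forall>v \<in> carrier (V x). g x u v = cnj (g x v u)))"

definition metric_matrix :: "nat \<Rightarrow> ('e \<Rightarrow> 'e \<Rightarrow> complex) \<Rightarrow> (nat \<Rightarrow> 'e) \<Rightarrow> complex mat" where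
  "metric_matrix n h b = mat n n (\<lambda>(i, j). h (b i) (b j))"

text \<open>Eigenvalues are counted with algebraic multiplicity.\<close>

definition num_pos_eigenvalues :: "complex mat \<Rightarrow> nat" where
  "num_pos_eigenvalues A =
     (\<Sum>a | 0 < a \<and> eigenvalue A (complex_of_real a).
        Polynomial.order (complex_of_real a) (char_poly A))"

definition num_neg_eigenvalues :: "complex mat \<Rightarrow> nat" where
  "num_neg_eigenvalues A =
     (\<Sum>a | a < 0 \<and> eigenvalue A (complex_of_real a).
        Polynomial.order (complex_of_real a) (char_poly A))"

text \<open>
  The basis used to represent \<open>g x\<close> is chosen arbitrarily; by Sylvester's law of inertia the
  signature does not depend on this choice.
\<close>

definition metric_signature ::
  "('b \<Rightarrow> (complex, 'e) module) \<Rightarrow> nat \<Rightarrow> ('b \<Rightarrow> 'e \<Rightarrow> 'e \<Rightarrow> complex) \<Rightarrow> 'b \<Rightarrow> int" where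
  "metric_signature V n g x =
     (let G = metric_matrix n (g x) (SOME b. ordered_basis (V x) n b)
      in int (num_pos_eigenvalues G) - int (num_neg_eigenvalues G))"

definition constant_signature_along ::
  "('b \<Rightarrow> (complex, 'e) module) \<Rightarrow> nat \<Rightarrow> ('b \<Rightarrow> 'e \<Rightarrow> 'e \<Rightarrow> complex) \<Rightarrow>
    real set \<Rightarrow> (real \<Rightarrow> 'b) \<Rightarrow> bool" where
  "constant_signature_along V n g J \<gamma> \<longleftrightarrow>
     (\<forall>s \<in> J. \<forall>t \<in> J. metric_signature V n g (\<gamma> s) = metric_signature V n g (\<gamma> t))"

text \<open>The list \<open>as\<close> enumerates the eigenvalues of \<open>A\<close> with their algebraic multiplicities.\<close>

definition first_eigenvalues_positive :: "nat \<Rightarrow> nat \<Rightarrow> complex mat \<Rightarrow> bool" where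
  "first_eigenvalues_positive n p A \<longleftrightarrow>
     (\<exists>as :: real list. length as = n \<and>
        char_poly A = (\<Prod>a\<leftarrow>as. [:- complex_of_real a, 1:]) \<and>
        (\<forall>i < p. 0 < as ! i) \<and> (\<forall>i. p \<le> i \<and> i < n \<longrightarrow> as ! i < 0))"

text \<open>
  A frame \<open>e\<close> is indexed by the parameter \<open>s\<close> and not by the point \<open>\<gamma> s\<close>, so different bases are
  allowed when the path passes through the same point again.
\<close>

definition adapted_frame ::
  "('b \<Rightarrow> (complex, 'e) module) \<Rightarrow> nat \<Rightarrow> ('b \<Rightarrow> 'e \<Rightarrow> 'e \<Rightarrow> complex) \<Rightarrow>
    real set \<Rightarrow> (real \<Rightarrow> 'b) \<Rightarrow> nat \<Rightarrow> (real \<Rightarrow> nat \<Rightarrow> 'e) \<Rightarrow> bool" where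
  "adapted_frame V n g J \<gamma> p e \<longleftrightarrow> p \<le> n \<and>
     (\<forall>s \<in> J. ordered_basis (V (\<gamma> s)) n (e s) \<and>
        first_eigenvalues_positive n p (metric_matrix n (g (\<gamma> s)) (e s)))"

definition G_pq :: "nat \<Rightarrow> nat \<Rightarrow> complex mat" where
  "G_pq p q = mat_diag (p + q) (\<lambda>i. if i < p then 1 else - 1)"

definition reducing_matrices ::
  "nat \<Rightarrow> ('b \<Rightarrow> 'e \<Rightarrow> 'e \<Rightarrow> complex) \<Rightarrow> real set \<Rightarrow> (real \<Rightarrow> 'b) \<Rightarrow> nat \<Rightarrow>
    (real \<Rightarrow> nat \<Rightarrow> 'e) \<Rightarrow> (real \<Rightarrow> complex mat) \<Rightarrow> bool" where
  "reducing_matrices n g J \<gamma> p e D \<longleftrightarrow>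
     (\<forall>s \<in> J. D s \<in> carrier_mat n n \<and>
        mat_adjoint (D s) * transpose_mat (metric_matrix n (g (\<gamma> s)) (e s)) * D s
          = G_pq p (n - p))"

definition pseudo_unitary :: "nat \<Rightarrow> nat \<Rightarrow> complex mat \<Rightarrow> bool" where
  "pseudo_unitary p q Z \<longleftrightarrow>
     Z \<in> carrier_mat (p + q) (p + q) \<and> mat_adjoint Z * G_pq p q * Z = G_pq p q"


section \<open>Linear transports along paths\<close>

definition linear_transport ::
  "'b topology \<Rightarrow> ('b \<Rightarrow> (complex, 'e) module) \<Rightarrow>
    (real set \<Rightarrow> (real \<Rightarrow> 'b) \<Rightarrow> real \<Rightarrow> real \<Rightarrow> 'e \<Rightarrow> 'e) \<Rightarrow> bool" where
  "linear_transport B V L \<longleftrightarrow>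
     (\<forall>J \<gamma>. path_in B J \<gamma> \<longrightarrow>
        (\<forall>s \<in> J. \<forall>t \<in> J. linear_map class_ring (V (\<gamma> s)) (V (\<gamma> t)) (L J \<gamma> s t)) \<and>
        (\<forall>r \<in> J. \<forall>s \<in> J. \<forall>t \<in> J. \<forall>u \<in> carrier (V (\<gamma> s)).
           L J \<gamma> t r (L J \<gamma> s t u) = L J \<gamma> s r u) \<and>
        (\<forall>s \<in> J. \<forall>u \<in> carrier (V (\<gamma> s)). L J \<gamma> s s u = u))"

definition consistent_along ::
  "('b \<Rightarrow> (complex, 'e) module) \<Rightarrow> ('b \<Rightarrow> 'e \<Rightarrow> 'e \<Rightarrow> complex) \<Rightarrow>
    (real set \<Rightarrow> (real \<Rightarrow> 'b) \<Rightarrow> real \<Rightarrow> real \<Rightarrow> 'e \<Rightarrow> 'e) \<Rightarrow>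
    real set \<Rightarrow> (real \<Rightarrow> 'b) \<Rightarrow> bool" where
  "consistent_along V g L J \<gamma> \<longleftrightarrow>
     (\<forall>s \<in> J. \<forall>t \<in> J. \<forall>u \<in> carrier (V (\<gamma> s)). \<forall>v \<in> carrier (V (\<gamma> s)).
        g (\<gamma> s) u v = g (\<gamma> t) (L J \<gamma> s t u) (L J \<gamma> s t v))"

text \<open>The matrix \<open>H(t, s; \<gamma>)\<close>; it exists and is unique when \<open>e s\<close> and \<open>e t\<close> are bases.\<close>

definition transport_matrix ::
  "('b \<Rightarrow> (complex, 'e) module) \<Rightarrow> nat \<Rightarrow>
    (real set \<Rightarrow> (real \<Rightarrow> 'b) \<Rightarrow> real \<Rightarrow> real \<Rightarrow> 'e \<Rightarrow> 'e) \<Rightarrow>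
    real set \<Rightarrow> (real \<Rightarrow> 'b) \<Rightarrow> (real \<Rightarrow> nat \<Rightarrow> 'e) \<Rightarrow> real \<Rightarrow> real \<Rightarrow> complex mat" where
  "transport_matrix V n L J \<gamma> e t s =
     (THE H. H \<in> carrier_mat n n \<and>
        (\<forall>j < n. L J \<gamma> s t (e s j) =
           (\<Oplus>\<^bsub>V (\<gamma> t)\<^esub> i \<in> {..<n}. (H $$ (i, j)) \<odot>\<^bsub>V (\<gamma> t)\<^esub> e t i)))"

text \<open>Meaningful only for invertible square matrices, which is how it is used below.\<close>

abbreviation inverse_mat :: "complex mat \<Rightarrow> complex mat" where
  "inverse_mat A \<equiv> the (mat_inverse A)"

definition defines_transport_matrix ::
  "('b \<Rightarrow> (complex, 'e) module) \<Rightarrow> nat \<Rightarrow>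
    (real set \<Rightarrow> (real \<Rightarrow> 'b) \<Rightarrow> real \<Rightarrow> real \<Rightarrow> 'e \<Rightarrow> 'e) \<Rightarrow>
    real set \<Rightarrow> (real \<Rightarrow> 'b) \<Rightarrow> (real \<Rightarrow> nat \<Rightarrow> 'e) \<Rightarrow> (real \<Rightarrow> complex mat) \<Rightarrow> bool" where
  "defines_transport_matrix V n L J \<gamma> e F \<longleftrightarrow>
     (\<forall>s \<in> J. F s \<in> carrier_mat n n \<and> invertible_mat (F s)) \<and>
     (\<forall>s \<in> J. \<forall>t \<in> J. transport_matrix V n L J \<gamma> e t s = inverse_mat (F t) * F s)"

definition pseudo_unitary_form ::
  "nat \<Rightarrow> real set \<Rightarrow> nat \<Rightarrow> (real \<Rightarrow> complex mat) \<Rightarrow> (real \<Rightarrow> complex mat) \<Rightarrow> bool" where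
  "pseudo_unitary_form n J p D F \<longleftrightarrow>
     (\<exists>Y Z. Y \<in> carrier_mat n n \<and> invertible_mat Y \<and>
        (\<forall>s \<in> J. pseudo_unitary p (n - p) (Z s) \<and> F s = Y * Z s * inverse_mat (D s)))"

end

theory Submission
  imports Defs
begin

text \<open>
  In frames along a path, consistency says \<open>H(t, s)\<^sup>* G(t)\<^sup>T H(t, s) = G(s)\<^sup>T\<close>: the matrices of the
  transport are congruences between the forms \<open>G\<^sup>T\<close>. Since \<open>D(s)\<close> is a congruence of \<open>G(s)\<^sup>T\<close> with
  \<open>G\<^sub>p\<^sub>q\<close>, the matrix \<open>Z(s) = D(s\<^sub>0)\<inverse> H(s\<^sub>0, s) D(s)\<close> is a congruence of \<open>G\<^sub>p\<^sub>q\<close> with itself, and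
  \<open>F(s) = Z(s) D(s)\<inverse>\<close> defines \<open>H\<close> because \<open>H(t, s) = H(s\<^sub>0, t)\<inverse> H(s\<^sub>0, s)\<close>. Conversely, if
  \<open>F(s) = Y Z(s) D(s)\<inverse>\<close>, then each \<open>F(s)\<close> is a congruence of \<open>G(s)\<^sup>T\<close> with one and the same
  form \<open>(Y\<inverse>)\<^sup>* G\<^sub>p\<^sub>q Y\<inverse>\<close>, so \<open>F(t)\<inverse> F(s)\<close> is a congruence of \<open>G(s)\<^sup>T\<close> with \<open>G(t)\<^sup>T\<close>.
\<close>

section \<open>Adjoints, inverses and congruence\<close>

lemma mat_adjoint_carrier: "A \<in> carrier_mat m k \<Longrightarrow> mat_adjoint A \<in> carrier_mat k m"
  by (auto simp: mat_adjoint_def)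

lemma mat_adjoint_index:
  assumes "A \<in> carrier_mat m k" "i < k" "j < m"
  shows "mat_adjoint A $$ (i, j) = conjugate (A $$ (j, i))"
  using assms by (auto simp: mat_adjoint_def mat_of_rows_def)

lemma mat_adjoint_one: "mat_adjoint (1\<^sub>m n :: complex mat) = 1\<^sub>m n"
  by (rule eq_matI) (auto simp: mat_adjoint_index[of _ n n] mat_adjoint_carrier[THEN carrier_matD(1), of _ n n]
      mat_adjoint_carrier[THEN carrier_matD(2), of _ n n])

lemma mat_adjoint_mult:
  assumes A: "A \<in> carrier_mat m k" and B: "(B :: complex mat) \<in> carrier_mat k l"
  shows "mat_adjoint (A * B) = mat_adjoint B * mat_adjoint A"
proof (rule eq_matI)
  have AB: "A * B \<in> carrier_mat m l"
    using A B by simp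
  have BA: "mat_adjoint B * mat_adjoint A \<in> carrier_mat l m"
    using A B by (meson mat_adjoint_carrier mult_carrier_mat)
  show "dim_row (mat_adjoint (A * B)) = dim_row (mat_adjoint B * mat_adjoint A)"
    "dim_col (mat_adjoint (A * B)) = dim_col (mat_adjoint B * mat_adjoint A)"
    using mat_adjoint_carrier[OF AB] BA by (metis carrier_matD)+
  fix i j
  assume "i < dim_row (mat_adjoint B * mat_adjoint A)"
    and "j < dim_col (mat_adjoint B * mat_adjoint A)"
  then have i: "i < l" and j: "j < m"
    using BA by (metis carrier_matD)+
  have dims: "dim_col (mat_adjoint B) = k" "dim_row (mat_adjoint B) = l"
    "dim_row (mat_adjoint A) = k" "dim_col (mat_adjoint A) = m"
    using A B by (meson mat_adjoint_carrier carrier_matD)+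
  show "mat_adjoint (A * B) $$ (i, j) = (mat_adjoint B * mat_adjoint A) $$ (i, j)"
    using A B i j dims
    by (simp add: mat_adjoint_index[OF AB] scalar_prod_def mat_adjoint_index[OF A]
        mat_adjoint_index[OF B] mult.commute)
qed

text \<open>For square matrices a one-sided inverse is two-sided, so \<open>A\<close> is a unit of
  the matrix ring and \<open>mat_inverse\<close> does return some \<open>C\<close>. Then
  \<open>C = C * (A * B) = (C * A) * B = B\<close>. This evaluates \<open>inverse_mat\<close> from
  an explicit inverse.\<close>

lemma inverse_mat_eqI:
  assumes A: "A \<in> carrier_mat n n" and B: "B \<in> carrier_mat n n" and AB: "A * B = 1\<^sub>m n"
  shows "inverse_mat A = B"
proof -
  have BA: "B * A = 1\<^sub>m n"
    by (rule mat_mult_left_right_inverse[OF A B AB])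
  have "A \<in> Units (ring_mat TYPE(complex) n ())"
    using A B AB BA by (auto simp: Units_def ring_mat_simps)
  then obtain C where C: "mat_inverse A = Some C"
    using mat_inverse(1)[OF A, of "()"] by blast
  have CA: "C * A = 1\<^sub>m n" and Cc: "C \<in> carrier_mat n n"
    using mat_inverse(2)[OF A C] by auto
  have "C = C * (A * B)"
    using Cc AB by simp
  also have "\<dots> = B"
    using Cc A B CA by (simp flip: assoc_mult_mat)
  finally show ?thesis
    using C by simp
qed

lemma invertible_matI:
  assumes "A \<in> carrier_mat n n" "B \<in> carrier_mat n n" "A * B = 1\<^sub>m n"
  shows "invertible_mat (A :: complex mat)"
  using assms mat_mult_left_right_inverse[OF assms]
  by (auto simp: invertible_mat_def inverts_mat_def intro!: exI[of _ B])

lemma inverse_mat: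
  assumes A: "A \<in> carrier_mat n n" and inv: "invertible_mat A"
  shows "inverse_mat A \<in> carrier_mat n n" "A * inverse_mat A = 1\<^sub>m n" "inverse_mat A * A = 1\<^sub>m n"
proof -
  obtain B where B: "A * B = 1\<^sub>m n" "B * A = 1\<^sub>m (dim_row B)"
    using A inv by (auto simp: invertible_mat_def inverts_mat_def)
  \<comment> \<open>The witness of \<open>invertible_mat\<close> comes without dimensions; comparing
    columns in the two product equations recovers them.\<close>
  have "dim_col B = n"
    using arg_cong[OF B(1), of dim_col] by simp
  moreover have "dim_row B = n"
    using arg_cong[OF B(2), of dim_col] A by simp
  ultimately have Bc: "B \<in> carrier_mat n n"
    by auto
  show "inverse_mat A \<in> carrier_mat n n" "A * inverse_mat A = 1\<^sub>m n" "inverse_mat A * A = 1\<^sub>m n"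
    using inverse_mat_eqI[OF A Bc B(1)] Bc B by auto
qed

text \<open>With \<open>M\<close> read as the form sending \<open>(x, y)\<close> to
  \<open>y\<^sup>* M x\<close>, this is its pullback along \<open>P\<close>. A metric enters through
  its transposed Gram matrix, being linear in the first argument.\<close>

definition congruent_mat :: "complex mat \<Rightarrow> complex mat \<Rightarrow> complex mat" where
  "congruent_mat P M = mat_adjoint P * M * P"

lemma congruent_mat_carrier:
  "P \<in> carrier_mat n n \<Longrightarrow> M \<in> carrier_mat n n \<Longrightarrow> congruent_mat P M \<in> carrier_mat n n"
  unfolding congruent_mat_def by (meson mat_adjoint_carrier mult_carrier_mat)

lemma congruent_mat_one: "M \<in> carrier_mat n n \<Longrightarrow> congruent_mat (1\<^sub>m n) M = M"
  by (simp add: congruent_mat_def mat_adjoint_one)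

text \<open>Pullback is contravariant, hence the reversed order: first along \<open>P\<close>, then
  along \<open>Q\<close>.\<close>

lemma congruent_mat_mult:
  assumes P: "P \<in> carrier_mat n n" and Q: "Q \<in> carrier_mat n n" and M: "M \<in> carrier_mat n n"
  shows "congruent_mat (P * Q) M = congruent_mat Q (congruent_mat P M)"
proof -
  have P': "mat_adjoint P \<in> carrier_mat n n" and Q': "mat_adjoint Q \<in> carrier_mat n n"
    using P Q by (simp_all add: mat_adjoint_carrier)
  show ?thesis
    unfolding congruent_mat_def mat_adjoint_mult[OF P Q]
    using P Q M P' Q' by (simp add: assoc_mult_mat[of _ n n _ n _ n])
qed

lemma congruent_mat_cancel:
  assumes "P \<in> carrier_mat n n" "Q \<in> carrier_mat n n" "M \<in> carrier_mat n n" "P * Q = 1\<^sub>m n"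
  shows "congruent_mat Q (congruent_mat P M) = M"
  using assms by (simp add: congruent_mat_one flip: congruent_mat_mult)

section \<open>The standard form and pseudo-unitary cocycles\<close>

lemma G_pq_carrier: "p \<le> n \<Longrightarrow> G_pq p (n - p) \<in> carrier_mat n n"
  by (simp add: G_pq_def)

lemma G_pq_square: "p \<le> n \<Longrightarrow> G_pq p (n - p) * G_pq p (n - p) = 1\<^sub>m n"
  unfolding G_pq_def by (simp add: if_distrib[of "\<lambda>x. x * _"] cong: if_cong)

text \<open>As \<open>G_pq\<close> squares to the identity, \<open>G_pq D\<^sup>* M\<close> is a left inverse of \<open>D\<close>.\<close>

lemma invertible_if_reduces_to_G_pq:
  assumes D: "D \<in> carrier_mat n n" and M: "M \<in> carrier_mat n n" and p: "p \<le> n"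
    and red: "congruent_mat D M = G_pq p (n - p)"
  shows "invertible_mat D"
proof -
  let ?G = "G_pq p (n - p)"
  have G: "?G \<in> carrier_mat n n" and D': "mat_adjoint D \<in> carrier_mat n n"
    using D p by (simp_all add: G_pq_carrier mat_adjoint_carrier)
  have left: "?G * (mat_adjoint D * M) \<in> carrier_mat n n"
    using G D' M by (meson mult_carrier_mat)
  have "?G * (mat_adjoint D * M) * D = ?G * congruent_mat D M"
    unfolding congruent_mat_def using G D' M D by (simp add: assoc_mult_mat[of _ n n _ n _ n])
  also have "\<dots> = 1\<^sub>m n"
    using red G_pq_square[OF p] by simp
  finally show ?thesis
    using invertible_matI[OF D left] mat_mult_left_right_inverse[OF left D] by simp
qed

text \<open>The matrix core of the result. In both directions every \<open>M s\<close> is the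
  pullback along \<open>F s\<close> of one form independent of \<open>s\<close>; this form is
  \<open>G_pq\<close> itself in the forward direction and a form congruent to it through
  \<open>Y\<close> in the converse.\<close>

theorem isometric_cocycle_iff_pseudo_unitary_form:
  fixes H :: "real \<Rightarrow> real \<Rightarrow> complex mat"
  assumes p: "p \<le> n" and ne: "J \<noteq> {}"
    and H: "\<And>s t. s \<in> J \<Longrightarrow> t \<in> J \<Longrightarrow> H t s \<in> carrier_mat n n"
    and H_id: "\<And>s. s \<in> J \<Longrightarrow> H s s = 1\<^sub>m n"
    and H_comp: "\<And>r s t. r \<in> J \<Longrightarrow> s \<in> J \<Longrightarrow> t \<in> J \<Longrightarrow> H r t * H t s = H r s"
    and M: "\<And>s. s \<in> J \<Longrightarrow> M s \<in> carrier_mat n n"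
    and D: "\<And>s. s \<in> J \<Longrightarrow> D s \<in> carrier_mat n n"
    and red: "\<And>s. s \<in> J \<Longrightarrow> congruent_mat (D s) (M s) = G_pq p (n - p)"
  shows "(\<forall>s\<in>J. \<forall>t\<in>J. congruent_mat (H t s) (M t) = M s) \<longleftrightarrow>
    (\<exists>F. (\<forall>s\<in>J. F s \<in> carrier_mat n n \<and> invertible_mat (F s)) \<and>
         (\<forall>s\<in>J. \<forall>t\<in>J. H t s = inverse_mat (F t) * F s) \<and> pseudo_unitary_form n J p D F)"
    (is "?isometric \<longleftrightarrow> (\<exists>F. ?defines F \<and> ?cocycle F \<and> ?form F)")
proof -
  define G where "G = G_pq p (n - p)"
  have G: "G \<in> carrier_mat n n"
    using p by (simp add: G_def G_pq_carrier)
  \<comment> \<open>By \<open>p \<le> n\<close> the truncated difference satisfies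
    \<open>p + (n - p) = n\<close>, so the sizes agree.\<close>
  have pseudo_unitary_iff: "pseudo_unitary p (n - p) Z \<longleftrightarrow>
      Z \<in> carrier_mat n n \<and> congruent_mat Z G = G" for Z
    using p by (simp add: pseudo_unitary_def congruent_mat_def G_def)
  define D' where "D' s = inverse_mat (D s)" for s
  have D': "D' s \<in> carrier_mat n n" "D s * D' s = 1\<^sub>m n" "D' s * D s = 1\<^sub>m n"
    if "s \<in> J" for s
    using inverse_mat[OF D invertible_if_reduces_to_G_pq[OF D M p red]] that
    by (simp_all add: D'_def)
  have unred: "congruent_mat (D' s) G = M s" if "s \<in> J" for s
    using congruent_mat_cancel[OF D D'(1) M D'(2), OF that that that that] red[OF that] by (simp add: G_def)
  show ?thesis
  proof
    assume iso: ?isometric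
    obtain s0 where s0: "s0 \<in> J"
      using ne by blast
    \<comment> \<open>Transport everything to one base parameter \<open>s0\<close>, and there pass
      to the coordinates in which the form is \<open>G\<close>.\<close>
    define F where "F s = D' s0 * H s0 s" for s
    have Fc: "F s \<in> carrier_mat n n" and Fc': "H s s0 * D s0 \<in> carrier_mat n n" if "s \<in> J" for s
      using that s0 H[of s s0] H[of s0 s] D'(1)[of s0] D[of s0]
      by (auto simp: F_def intro: mult_carrier_mat)
    \<comment> \<open>An explicit inverse of \<open>F s\<close>, built from the reverse transport;
      it gives invertibility and also evaluates \<open>inverse_mat (F t)\<close> in the cocycle
      equation.\<close>
    have F_inv: "F s * (H s s0 * D s0) = 1\<^sub>m n" if s: "s \<in> J" for s
    proof -
      have "F s * (H s s0 * D s0) = D' s0 * (H s0 s * H s s0) * D s0"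
        unfolding F_def using s s0 H[of s s0] H[of s0 s] D'(1)[of s0] D[of s0]
        by (simp add: assoc_mult_mat[of _ n n _ n _ n])
      also have "\<dots> = 1\<^sub>m n"
        using s s0 D'(1)[of s0] D'(3) by (simp add: H_comp H_id)
      finally show ?thesis .
    qed
    have "?defines F"
      using Fc Fc' F_inv invertible_matI by blast
    moreover have "?cocycle F"
    proof (intro ballI)
      fix s t
      assume s: "s \<in> J" and t: "t \<in> J"
      have "inverse_mat (F t) * F s = H t s0 * (D s0 * D' s0) * H s0 s"
        unfolding inverse_mat_eqI[OF Fc[OF t] Fc'[OF t] F_inv[OF t]] F_def[of s]
        using s t s0 H[of s0 t] H[of s s0] D'(1)[of s0] D[of s0]
        by (simp add: assoc_mult_mat[of _ n n _ n _ n])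
      also have "\<dots> = H t s"
        using s t s0 H[of s0 t] by (simp add: D' H_comp)
      finally show "H t s = inverse_mat (F t) * F s" ..
    qed
    moreover have "?form F"
      unfolding pseudo_unitary_form_def pseudo_unitary_iff
    \<comment> \<open>With \<open>Y\<close> the identity, the required shape forces
      \<open>Z s = F s * D s\<close>.\<close>
    proof (intro exI[of _ "1\<^sub>m n"] exI[of _ "\<lambda>s. F s * D s"] conjI ballI)
      show "invertible_mat (1\<^sub>m n :: complex mat)"
        by (rule invertible_matI[of _ n "1\<^sub>m n"]) auto
      fix s
      assume s: "s \<in> J"
      show "F s * D s \<in> carrier_mat n n"
        using Fc[OF s] D[OF s] by simp
      \<comment> \<open>\<open>D' s0\<close> pulls \<open>G\<close> back to \<open>M s0\<close>, and
        the isometry \<open>H s0 s\<close> pulls \<open>M s0\<close> back to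
        \<open>M s\<close>.\<close>
      have "congruent_mat (F s) G = congruent_mat (H s0 s) (congruent_mat (D' s0) G)"
        unfolding F_def by (rule congruent_mat_mult[OF D'(1)[OF s0] H[OF s s0] G])
      also have "\<dots> = M s"
        using iso s s0 by (simp add: unred)
      finally show "congruent_mat (F s * D s) G = G"
        using congruent_mat_mult[OF Fc[OF s] D[OF s] G] red[OF s] by (simp add: G_def)
      show "F s = 1\<^sub>m n * (F s * D s) * inverse_mat (D s)"
        using Fc[OF s] D[OF s] D'[OF s] by (simp add: D'_def)
    qed simp
    ultimately show "\<exists>F. ?defines F \<and> ?cocycle F \<and> ?form F"
      by blast
  next
    assume "\<exists>F. ?defines F \<and> ?cocycle F \<and> ?form F"
    then obtain F Y Z where F: "?defines F" and cocycle: "?cocycle F"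
      and Y: "Y \<in> carrier_mat n n" "invertible_mat Y"
      and Z: "\<And>s. s \<in> J \<Longrightarrow> Z s \<in> carrier_mat n n \<and> congruent_mat (Z s) G = G"
      and form: "\<And>s. s \<in> J \<Longrightarrow> F s = Y * Z s * D' s"
      by (auto simp: pseudo_unitary_form_def pseudo_unitary_iff D'_def)
    \<comment> \<open>\<open>Q\<close> is the common form: it is chosen so that its pullback along
      \<open>Y\<close> is \<open>G\<close>.\<close>
    define Q where "Q = congruent_mat (inverse_mat Y) G"
    have Q: "Q \<in> carrier_mat n n"
      unfolding Q_def using inverse_mat(1)[OF Y] G by (rule congruent_mat_carrier)
    have YQ: "congruent_mat Y Q = G"
      unfolding Q_def by (rule congruent_mat_cancel[OF _ Y(1) G]) (simp_all add: inverse_mat[OF Y])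
    \<comment> \<open>Along the factors of \<open>F s\<close>, the form \<open>Q\<close> becomes
      \<open>G\<close> by \<open>Y\<close>, stays \<open>G\<close> by \<open>Z s\<close>, and
      becomes \<open>M s\<close> by \<open>D' s\<close>.\<close>
    have FQ: "congruent_mat (F s) Q = M s" if s: "s \<in> J" for s
      using congruent_mat_mult[OF mult_carrier_mat[OF Y(1)] D'(1)[OF s] Q, of "Z s"]
        congruent_mat_mult[OF Y(1) _ Q, of "Z s"] Z[OF s] unred[OF s]
      by (simp add: form[OF s] YQ)
    show ?isometric
    proof (intro ballI)
      fix s t
      assume s: "s \<in> J" and t: "t \<in> J"
      note Ft = bspec[OF F t, THEN conjunct1] bspec[OF F t, THEN conjunct2]
      have "congruent_mat (inverse_mat (F t) * F s) (M t) =
          congruent_mat (F s) (congruent_mat (inverse_mat (F t)) (M t))"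
        by (rule congruent_mat_mult) (use F s t M inverse_mat[OF Ft] in auto)
      also have "congruent_mat (inverse_mat (F t)) (M t) = Q"
        unfolding FQ[OF t, symmetric]
        by (rule congruent_mat_cancel[OF Ft(1) _ Q]) (simp_all add: inverse_mat[OF Ft])
      finally show "congruent_mat (H t s) (M t) = M s"
        using cocycle s t FQ by simp
    qed
  qed
qed

section \<open>Coordinates in a frame\<close>

definition frame_comb :: "(complex, 'e) module \<Rightarrow> nat \<Rightarrow> (nat \<Rightarrow> 'e) \<Rightarrow> (nat \<Rightarrow> complex) \<Rightarrow> 'e" where
  "frame_comb W n b x = (\<Oplus>\<^bsub>W\<^esub> i \<in> {..<n}. x i \<odot>\<^bsub>W\<^esub> b i)"

text \<open>The part of a bundle metric at a point that every pullback along a linear map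
  inherits.\<close>

definition sesquilinear :: "(complex, 'e) module \<Rightarrow> ('e \<Rightarrow> 'e \<Rightarrow> complex) \<Rightarrow> bool" where
  "sesquilinear W h \<longleftrightarrow>
     (\<forall>u \<in> carrier W. \<forall>v \<in> carrier W. \<forall>w \<in> carrier W.
        h (u \<oplus>\<^bsub>W\<^esub> v) w = h u w + h v w \<and> h w (u \<oplus>\<^bsub>W\<^esub> v) = h w u + h w v) \<and>
     (\<forall>c. \<forall>u \<in> carrier W. \<forall>v \<in> carrier W.
        h (c \<odot>\<^bsub>W\<^esub> u) v = c * h u v \<and> h u (c \<odot>\<^bsub>W\<^esub> v) = cnj c * h u v)"

locale vector_frame = vectorspace "class_ring :: complex ring" W
  for W :: "(complex, 'e) module" +
  fixes n :: nat and b :: "nat \<Rightarrow> 'e"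
  assumes ordered_basis: "ordered_basis W n b"
begin

lemma inj_frame: "inj_on b {..<n}" and basis_frame: "basis (b ` {..<n})"
  using ordered_basis by (simp_all add: ordered_basis_def)

lemma frame_carrier: "i < n \<Longrightarrow> b i \<in> carrier W"
  using basis_frame by (auto simp: basis_def)

lemma smult_frame_carrier: "i < n \<Longrightarrow> c \<odot>\<^bsub>W\<^esub> b i \<in> carrier W"
  by (simp add: frame_carrier)

lemma frame_comb_closed: "frame_comb W n b x \<in> carrier W"
  unfolding frame_comb_def by (rule finsum_closed) (auto intro: smult_frame_carrier)

lemma frame_comb_cong: "(\<And>i. i < n \<Longrightarrow> x i = y i) \<Longrightarrow> frame_comb W n b x = frame_comb W n b y"
  unfolding frame_comb_def
  by (rule finsum_cong') (auto intro: smult_frame_carrier)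

lemma frame_comb_add:
  "frame_comb W n b (\<lambda>i. x i + y i) = frame_comb W n b x \<oplus>\<^bsub>W\<^esub> frame_comb W n b y"
proof -
  have "frame_comb W n b (\<lambda>i. x i + y i) =
      (\<Oplus>\<^bsub>W\<^esub> i \<in> {..<n}. x i \<odot>\<^bsub>W\<^esub> b i \<oplus>\<^bsub>W\<^esub> y i \<odot>\<^bsub>W\<^esub> b i)"
    unfolding frame_comb_def
    by (rule finsum_cong') (use smult_l_distr in \<open>auto simp: frame_carrier\<close>)
  also have "\<dots> = frame_comb W n b x \<oplus>\<^bsub>W\<^esub> frame_comb W n b y"
    unfolding frame_comb_def by (rule finsum_addf) (auto simp: frame_carrier)
  finally show ?thesis .
qed

lemma frame_comb_smult: "frame_comb W n b (\<lambda>i. c * x i) = c \<odot>\<^bsub>W\<^esub> frame_comb W n b x"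
proof -
  have "frame_comb W n b (\<lambda>i. c * x i) = (\<Oplus>\<^bsub>W\<^esub> i \<in> {..<n}. c \<odot>\<^bsub>W\<^esub> (x i \<odot>\<^bsub>W\<^esub> b i))"
    unfolding frame_comb_def
    by (rule finsum_cong') (use smult_assoc1 in \<open>auto simp: frame_carrier\<close>)
  also have "\<dots> = c \<odot>\<^bsub>W\<^esub> frame_comb W n b x"
    unfolding frame_comb_def by (rule finsum_smult[symmetric]) (auto simp: frame_carrier)
  finally show ?thesis .
qed

lemma frame_comb_zero: "frame_comb W n b (\<lambda>_. 0) = \<zero>\<^bsub>W\<^esub>"
  using frame_comb_smult[of 0 "\<lambda>_. 0"] lmult_0[OF frame_comb_closed] by simp

lemma frame_comb_unit: "j < n \<Longrightarrow> frame_comb W n b (\<lambda>i. if i = j then 1 else 0) = b j"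
proof -
  assume j: "j < n"
  have "frame_comb W n b (\<lambda>i. if i = j then 1 else 0) =
      (\<Oplus>\<^bsub>W\<^esub> i \<in> {..<n}. if j = i then b i else \<zero>\<^bsub>W\<^esub>)"
    unfolding frame_comb_def
    by (rule finsum_cong') (use smult_one lmult_0 in \<open>auto simp: frame_carrier\<close>)
  also have "\<dots> = b j"
    using j by (intro finsum_singleton) (auto simp: frame_carrier)
  finally show ?thesis .
qed

text \<open>Library combinations have coefficients attached to vectors, frame combinations to
  indices; injectivity of \<open>b\<close> translates between them.\<close>

lemma lincomb_frame:
  "lincomb a (b ` {..<n}) = frame_comb W n b (\<lambda>i. a (b i))"
  unfolding lincomb_def frame_comb_def
  by (rule finsum_reindex) (auto simp: frame_carrier inj_frame)

lemma frame_comb_surj: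
  assumes "v \<in> carrier W"
  obtains x where "v = frame_comb W n b x"
proof -
  have "b ` {..<n} \<subseteq> carrier W"
    by (auto simp: frame_carrier)
  then obtain a where "lincomb a (b ` {..<n}) = v"
    using basis_criterion[of "b ` {..<n}"] basis_frame assms by blast
  then show ?thesis
    using that lincomb_frame by metis
qed

lemma frame_comb_inj:
  assumes eq: "frame_comb W n b x = frame_comb W n b y" and i: "i < n"
  shows "x i = y i"
proof -
  \<comment> \<open>Moves coordinates from indices to basis vectors. The restriction makes
    \<open>ext z\<close> extensional, the setting in which the basis criterion asserts uniqueness of
    coefficient functions.\<close>
  define ext where "ext z = (\<lambda>v\<in>b ` {..<n}. z (the_inv_into {..<n} b v))" for z :: "nat \<Rightarrow> complex"
  have ext_frame: "ext z (b j) = z j" if "j < n" for z j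
    using that by (simp add: ext_def the_inv_into_f_f[OF inj_frame])
  have lc: "lincomb (ext z) (b ` {..<n}) = frame_comb W n b z" for z
    unfolding lincomb_frame by (rule frame_comb_cong) (rule ext_frame)
  have "b ` {..<n} \<subseteq> carrier W"
    by (auto simp: frame_carrier)
  then have "\<exists>!a. a \<in> b ` {..<n} \<rightarrow>\<^sub>E UNIV \<and> lincomb a (b ` {..<n}) = frame_comb W n b x"
    using basis_criterion[of "b ` {..<n}"] basis_frame frame_comb_closed by auto
  moreover have "ext z \<in> b ` {..<n} \<rightarrow>\<^sub>E UNIV" for z
    by (auto simp: ext_def)
  ultimately have "ext x = ext y"
    using lc eq by metis
  then show ?thesis
    using ext_frame i by metis
qed

text \<open>Leaving \<open>\<sigma>\<close> open serves both arguments of a sesquilinear form: the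
  identity for the first, conjugation for the second.\<close>

lemma semilinear_functional_frame_comb:
  assumes add: "\<And>u v. u \<in> carrier W \<Longrightarrow> v \<in> carrier W \<Longrightarrow> f (u \<oplus>\<^bsub>W\<^esub> v) = f u + f v"
    and smult: "\<And>c u. u \<in> carrier W \<Longrightarrow> f (c \<odot>\<^bsub>W\<^esub> u) = \<sigma> c * f u"
  shows "f (frame_comb W n b x) = (\<Sum>i<n. \<sigma> (x i) * (f (b i) :: complex))"
proof -
  have zero: "f \<zero>\<^bsub>W\<^esub> = 0"
    using add[of "\<zero>\<^bsub>W\<^esub>" "\<zero>\<^bsub>W\<^esub>"] by simp
  \<comment> \<open>Generalised to subsets \<open>A\<close> of the index set so that induction on
    finite sets applies.\<close>
  have "finite A \<Longrightarrow> A \<subseteq> {..<n} \<Longrightarrow>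
      f (\<Oplus>\<^bsub>W\<^esub> i \<in> A. x i \<odot>\<^bsub>W\<^esub> b i) = (\<Sum>i\<in>A. \<sigma> (x i) * f (b i))" for A
  proof (induction A rule: finite_induct)
    case (insert i A)
    then have closed: "(\<lambda>i. x i \<odot>\<^bsub>W\<^esub> b i) \<in> A \<rightarrow> carrier W" "x i \<odot>\<^bsub>W\<^esub> b i \<in> carrier W"
      by (auto intro!: smult_frame_carrier)
    have "f (x i \<odot>\<^bsub>W\<^esub> b i) = \<sigma> (x i) * f (b i)"
      using insert.prems by (intro smult frame_carrier) auto
    then show ?case
      using insert closed by (simp add: add finsum_closed)
  qed (simp add: zero)
  then show ?thesis
    by (simp add: frame_comb_def)
qed

lemma sesquilinear_frame_comb:
  assumes h: "sesquilinear W h"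
  shows "h (frame_comb W n b x) (frame_comb W n b y) =
    (\<Sum>i<n. \<Sum>j<n. x i * cnj (y j) * h (b i) (b j))"
proof -
  have "h (frame_comb W n b x) (frame_comb W n b y) =
      (\<Sum>i<n. x i * h (b i) (frame_comb W n b y))"
    by (rule semilinear_functional_frame_comb[where \<sigma> = "\<lambda>c. c"])
      (use h frame_comb_closed in \<open>auto simp: sesquilinear_def\<close>)
  also have "h (b i) (frame_comb W n b y) = (\<Sum>j<n. cnj (y j) * h (b i) (b j))" if "i < n" for i
    by (rule semilinear_functional_frame_comb[where \<sigma> = cnj])
      (use h frame_carrier[OF that] in \<open>auto simp: sesquilinear_def\<close>)
  then have "(\<Sum>i<n. x i * h (b i) (frame_comb W n b y)) =
      (\<Sum>i<n. \<Sum>j<n. x i * cnj (y j) * h (b i) (b j))"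
    by (intro sum.cong) (simp_all add: sum_distrib_left mult.assoc)
  finally show ?thesis .
qed

text \<open>A sesquilinear form is determined by its values on pairs of basis vectors. This turns
  consistency into a matrix equation.\<close>

lemma sesquilinear_eq_iff_metric_matrix_eq:
  assumes h: "sesquilinear W h" and k: "sesquilinear W k"
  shows "(\<forall>u\<in>carrier W. \<forall>v\<in>carrier W. h u v = k u v) \<longleftrightarrow>
    metric_matrix n h b = metric_matrix n k b"
proof
  assume "\<forall>u\<in>carrier W. \<forall>v\<in>carrier W. h u v = k u v"
  then show "metric_matrix n h b = metric_matrix n k b"
    by (auto simp: metric_matrix_def frame_carrier intro!: eq_matI)
next
  assume eq: "metric_matrix n h b = metric_matrix n k b"
  have "h (b i) (b j) = k (b i) (b j)" if "i < n" "j < n" for i j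
    using arg_cong[OF eq, of "\<lambda>G. G $$ (i, j)"] that by (simp add: metric_matrix_def)
  then have "h (frame_comb W n b x) (frame_comb W n b y) =
      k (frame_comb W n b x) (frame_comb W n b y)" for x y
    by (simp add: sesquilinear_frame_comb[OF h] sesquilinear_frame_comb[OF k])
  then show "\<forall>u\<in>carrier W. \<forall>v\<in>carrier W. h u v = k u v"
    by (metis frame_comb_surj)
qed

text \<open>The entry \<open>(j, i)\<close> is \<open>h (c i) (c j)\<close>: conjugated coefficients
  come from column \<open>j\<close> of \<open>H\<close> and plain ones from column \<open>i\<close>.
  This is why the transposed Gram matrix is the one that transforms by congruence.\<close>

lemma transpose_metric_matrix_frame_change:
  assumes h: "sesquilinear W h" and H: "H \<in> carrier_mat n n"
    and c: "\<And>j. j < n \<Longrightarrow> c j = frame_comb W n b (\<lambda>i. H $$ (i, j))"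
  shows "transpose_mat (metric_matrix n h c) =
    congruent_mat H (transpose_mat (metric_matrix n h b))"
proof (rule eq_matI)
  have G: "transpose_mat (metric_matrix n h b) \<in> carrier_mat n n"
    by (simp add: metric_matrix_def)
  note R = congruent_mat_carrier[OF H G]
  show "dim_row (transpose_mat (metric_matrix n h c)) =
      dim_row (congruent_mat H (transpose_mat (metric_matrix n h b)))"
    "dim_col (transpose_mat (metric_matrix n h c)) =
      dim_col (congruent_mat H (transpose_mat (metric_matrix n h b)))"
    using R by (simp_all add: metric_matrix_def)
  fix j i
  assume "j < dim_row (congruent_mat H (transpose_mat (metric_matrix n h b)))"
    and "i < dim_col (congruent_mat H (transpose_mat (metric_matrix n h b)))"
  then have j: "j < n" and i: "i < n"
    using R by simp_all
  note H' = mat_adjoint_carrier[OF H]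
  have "transpose_mat (metric_matrix n h c) $$ (j, i) =
      (\<Sum>k<n. \<Sum>l<n. H $$ (k, i) * cnj (H $$ (l, j)) * h (b k) (b l))"
    using i j by (simp add: metric_matrix_def c sesquilinear_frame_comb[OF h])
  also have "\<dots> = (\<Sum>k<n. (\<Sum>l<n. cnj (H $$ (l, j)) * h (b k) (b l)) * H $$ (k, i))"
    by (simp add: sum_distrib_right sum_distrib_left mult_ac)
  also have "\<dots> = congruent_mat H (transpose_mat (metric_matrix n h b)) $$ (j, i)"
    using i j H H' G unfolding congruent_mat_def
    by (simp add: scalar_prod_def mat_adjoint_index[OF H] metric_matrix_def lessThan_atLeast0)
  finally show "transpose_mat (metric_matrix n h c) $$ (j, i) =
      congruent_mat H (transpose_mat (metric_matrix n h b)) $$ (j, i)" .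
qed

text \<open>Column \<open>j\<close> must list the coordinates of \<open>c j\<close>, which exist as
  the frame spans and are unique as it is independent. This justifies the definite description in
  \<open>transport_matrix\<close>.\<close>

lemma ex1_frame_matrix:
  assumes c: "\<And>j. j < n \<Longrightarrow> c j \<in> carrier W"
  shows "\<exists>!H. H \<in> carrier_mat n n \<and> (\<forall>j<n. c j = frame_comb W n b (\<lambda>i. H $$ (i, j)))"
proof -
  obtain X where X: "\<And>j. j < n \<Longrightarrow> c j = frame_comb W n b (X j)"
  proof -
    have "\<forall>j\<in>{..<n}. \<exists>x. c j = frame_comb W n b x"
      by (meson c frame_comb_surj lessThan_iff)
    then show ?thesis
      using that by (auto dest: bchoice)
  qed
  show ?thesis
  proof (rule ex1I[of _ "Matrix.mat n n (\<lambda>(i, j). X j i)"])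
    have "frame_comb W n b (X j) =
        frame_comb W n b (\<lambda>i. Matrix.mat n n (\<lambda>(i, j). X j i) $$ (i, j))" if "j < n" for j
      by (rule frame_comb_cong) (simp add: that)
    with X show "Matrix.mat n n (\<lambda>(i, j). X j i) \<in> carrier_mat n n \<and>
        (\<forall>j<n. c j = frame_comb W n b (\<lambda>i. Matrix.mat n n (\<lambda>(i, j). X j i) $$ (i, j)))"
      by (intro conjI allI impI mat_carrier) (rule trans)
  next
    fix H
    assume H: "H \<in> carrier_mat n n \<and> (\<forall>j<n. c j = frame_comb W n b (\<lambda>i. H $$ (i, j)))"
    have coords: "H $$ (i, j) = X j i" if "i < n" "j < n" for i j
    proof (rule frame_comb_inj[OF _ that(1)])
      show "frame_comb W n b (\<lambda>i. H $$ (i, j)) = frame_comb W n b (X j)"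
        using H X[OF that(2)] that(2) by metis
    qed
    show "H = Matrix.mat n n (\<lambda>(i, j). X j i)"
    proof (rule eq_matI)
      fix i j
      assume "i < dim_row (Matrix.mat n n (\<lambda>(i, j). X j i))"
        "j < dim_col (Matrix.mat n n (\<lambda>(i, j). X j i))"
      then show "H $$ (i, j) = Matrix.mat n n (\<lambda>(i, j). X j i) $$ (i, j)"
        using coords by simp
    qed (use H in auto)
  qed
qed

end

section \<open>Linear maps and transports in coordinates\<close>

lemma linear_map_class_ringD:
  assumes "linear_map class_ring W W' T" and u: "u \<in> carrier W"
  shows "T u \<in> carrier W'"
    and "v \<in> carrier W \<Longrightarrow> T (u \<oplus>\<^bsub>W\<^esub> v) = T u \<oplus>\<^bsub>W'\<^esub> T v"
    and "T (c \<odot>\<^bsub>W\<^esub> u) = c \<odot>\<^bsub>W'\<^esub> T u"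
proof -
  have T: "T \<in> module_hom class_ring W W'"
    using assms(1) by (simp add: linear_map_def mod_hom_def mod_hom_axioms_def)
  then show "T u \<in> carrier W'" "v \<in> carrier W \<Longrightarrow> T (u \<oplus>\<^bsub>W\<^esub> v) = T u \<oplus>\<^bsub>W'\<^esub> T v"
    using u by (auto dest: module_hom_closed module_hom_add)
  show "T (c \<odot>\<^bsub>W\<^esub> u) = c \<odot>\<^bsub>W'\<^esub> T u"
    by (rule module_hom_smult[OF T _ u]) simp
qed

lemma linear_map_frame_comb:
  assumes T: "linear_map class_ring W W' T"
    and frame: "vector_frame W n b" and frame': "vector_frame W' n b'"
    and H: "\<And>j. j < n \<Longrightarrow> T (b j) = frame_comb W' n b' (\<lambda>i. H $$ (i, j))"
  shows "T (frame_comb W n b x) = frame_comb W' n b' (\<lambda>i. \<Sum>j<n. H $$ (i, j) * x j)"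
proof -
  interpret W: vector_frame W n b
    by (rule frame)
  interpret W': vector_frame W' n b'
    by (rule frame')
  note add = linear_map_class_ringD(2)[OF T]
  note smult = linear_map_class_ringD(3)[OF T]
  have zero: "T \<zero>\<^bsub>W\<^esub> = \<zero>\<^bsub>W'\<^esub>"
    using smult[OF W.zero_closed, of 0] linear_map_class_ringD(1)[OF T W.zero_closed] W.lmult_0 W'.lmult_0
    by simp
  have step: "T (x j \<odot>\<^bsub>W\<^esub> b j) = frame_comb W' n b' (\<lambda>i. H $$ (i, j) * x j)" if "j < n" for j
    using that W'.frame_comb_smult[of "x j" "\<lambda>i. H $$ (i, j)"]
    by (simp add: smult W.frame_carrier H mult.commute)
  have "finite A \<Longrightarrow> A \<subseteq> {..<n} \<Longrightarrow> T (\<Oplus>\<^bsub>W\<^esub> j \<in> A. x j \<odot>\<^bsub>W\<^esub> b j) =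
      frame_comb W' n b' (\<lambda>i. \<Sum>j\<in>A. H $$ (i, j) * x j)" for A
  proof (induction A rule: finite_induct)
    case (insert j A)
    then have "(\<lambda>j. x j \<odot>\<^bsub>W\<^esub> b j) \<in> A \<rightarrow> carrier W" "x j \<odot>\<^bsub>W\<^esub> b j \<in> carrier W"
      by (auto intro!: W.smult_frame_carrier)
    then show ?case
      using insert step[of j] by (simp add: add W.finsum_closed W'.frame_comb_add)
  qed (simp add: W'.frame_comb_zero zero)
  then show ?thesis
    by (simp add: frame_comb_def)
qed

text \<open>Lets consistency be read as equality of two sesquilinear forms on the same
  fibre.\<close>

lemma sesquilinear_pullback:
  assumes T: "linear_map class_ring W W' T" and h: "sesquilinear W' h"
  shows "sesquilinear W (\<lambda>u v. h (T u) (T v))"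
proof -
  note TD = linear_map_class_ringD[OF T]
  show ?thesis
    unfolding sesquilinear_def
  proof (intro conjI ballI allI)
    fix c u v w
    assume [simp]: "u \<in> carrier W" "v \<in> carrier W"
    show "h (T (c \<odot>\<^bsub>W\<^esub> u)) (T v) = c * h (T u) (T v)"
      "h (T u) (T (c \<odot>\<^bsub>W\<^esub> v)) = cnj c * h (T u) (T v)"
      using h TD(1)[of u] TD(1)[of v] TD(3)[of u c] TD(3)[of v c] by (simp_all add: sesquilinear_def)
    assume [simp]: "w \<in> carrier W"
    show "h (T (u \<oplus>\<^bsub>W\<^esub> v)) (T w) = h (T u) (T w) + h (T v) (T w)"
      "h (T w) (T (u \<oplus>\<^bsub>W\<^esub> v)) = h (T w) (T u) + h (T w) (T v)"
      using h TD(1)[of u] TD(1)[of v] TD(1)[of w] TD(2)[of u v] by (simp_all add: sesquilinear_def)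
  qed
qed

lemma transport_matrix_altdef:
  "transport_matrix V n L J \<gamma> e t s = (THE H. H \<in> carrier_mat n n \<and>
     (\<forall>j<n. L J \<gamma> s t (e s j) = frame_comb (V (\<gamma> t)) n (e t) (\<lambda>i. H $$ (i, j))))"
  by (simp only: transport_matrix_def frame_comb_def)

lemma transport_matrix_eqI:
  assumes frame: "vector_frame (V (\<gamma> t)) n (e t)" and H: "H \<in> carrier_mat n n"
    and L: "\<And>j. j < n \<Longrightarrow> L J \<gamma> s t (e s j) = frame_comb (V (\<gamma> t)) n (e t) (\<lambda>i. H $$ (i, j))"
  shows "transport_matrix V n L J \<gamma> e t s = H"
proof -
  interpret vector_frame "V (\<gamma> t)" n "e t"
    by (rule frame)
  show ?thesis
    unfolding transport_matrix_altdef
  proof (rule the1_equality[OF ex1_frame_matrix[of "\<lambda>j. L J \<gamma> s t (e s j)"]])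
    show "L J \<gamma> s t (e s j) \<in> carrier (V (\<gamma> t))" if "j < n" for j
      unfolding L[OF that] by (rule frame_comb_closed)
    show "H \<in> carrier_mat n n \<and> (\<forall>j<n. L J \<gamma> s t (e s j) =
        frame_comb (V (\<gamma> t)) n (e t) (\<lambda>i. H $$ (i, j)))"
      using H L by simp
  qed
qed

lemma transport_matrix:
  assumes T: "linear_map class_ring (V (\<gamma> s)) (V (\<gamma> t)) (L J \<gamma> s t)"
    and frame_s: "vector_frame (V (\<gamma> s)) n (e s)" and frame_t: "vector_frame (V (\<gamma> t)) n (e t)"
  shows "transport_matrix V n L J \<gamma> e t s \<in> carrier_mat n n"
    and "j < n \<Longrightarrow> L J \<gamma> s t (e s j) =
      frame_comb (V (\<gamma> t)) n (e t) (\<lambda>i. transport_matrix V n L J \<gamma> e t s $$ (i, j))"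
proof -
  interpret S: vector_frame "V (\<gamma> s)" n "e s"
    by (rule frame_s)
  interpret T': vector_frame "V (\<gamma> t)" n "e t"
    by (rule frame_t)
  have "L J \<gamma> s t (e s j) \<in> carrier (V (\<gamma> t))" if "j < n" for j
    by (rule linear_map_class_ringD(1)[OF T S.frame_carrier[OF that]])
  then have "transport_matrix V n L J \<gamma> e t s \<in> carrier_mat n n \<and>
      (\<forall>j<n. L J \<gamma> s t (e s j) =
        frame_comb (V (\<gamma> t)) n (e t) (\<lambda>i. transport_matrix V n L J \<gamma> e t s $$ (i, j)))"
    unfolding transport_matrix_altdef
    by (intro theI'[OF T'.ex1_frame_matrix[of "\<lambda>j. L J \<gamma> s t (e s j)"]])
  then show "transport_matrix V n L J \<gamma> e t s \<in> carrier_mat n n"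
    and "j < n \<Longrightarrow> L J \<gamma> s t (e s j) =
      frame_comb (V (\<gamma> t)) n (e t) (\<lambda>i. transport_matrix V n L J \<gamma> e t s $$ (i, j))"
    by blast+
qed

section \<open>Consistency along one path\<close>

text \<open>Frames along the path turn the transport into a matrix cocycle \<open>H\<close> and the
  metric into forms \<open>M\<close>, to which the matrix equivalence applies.\<close>

lemma consistent_along_iff_pseudo_unitary_form:
  assumes vector_bundle: "complex_vector_bundle E \<pi> B V n"
    and metric: "hermitian_bundle_metric B V g"
    and transport: "linear_transport B V L"
    and path: "path_in B J \<gamma>"
    and adapted: "adapted_frame V n g J \<gamma> p e"
    and reducing: "reducing_matrices n g J \<gamma> p e D"
  shows "consistent_along V g L J \<gamma> \<longleftrightarrow>
    (\<exists>F. defines_transport_matrix V n L J \<gamma> e F \<and> pseudo_unitary_form n J p D F)"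
proof -
  interpret complex_vector_bundle E \<pi> B V n
    by (rule vector_bundle)
  define H where "H t s = transport_matrix V n L J \<gamma> e t s" for t s
  define M where "M s = transpose_mat (metric_matrix n (g (\<gamma> s)) (e s))" for s
  have in_base: "\<gamma> s \<in> topspace B" if "s \<in> J" for s
    using path that by (auto simp: path_in_def continuous_map_def)
  have frame: "vector_frame (V (\<gamma> s)) n (e s)" if "s \<in> J" for s
    using that adapted fibre_vectorspace[OF in_base]
    by (simp add: vector_frame_def vector_frame_axioms_def adapted_frame_def)
  have sesq: "sesquilinear (V (\<gamma> s)) (g (\<gamma> s))" if "s \<in> J" for s
    using metric in_base[OF that] unfolding hermitian_bundle_metric_def sesquilinear_def by blast
  have lin: "linear_map class_ring (V (\<gamma> s)) (V (\<gamma> t)) (L J \<gamma> s t)" if "s \<in> J" "t \<in> J" for s t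
    using transport path that unfolding linear_transport_def by blast
  have L_comp: "L J \<gamma> t r (L J \<gamma> s t u) = L J \<gamma> s r u"
    if "r \<in> J" "s \<in> J" "t \<in> J" "u \<in> carrier (V (\<gamma> s))" for r s t u
    using transport path that unfolding linear_transport_def by blast
  have L_id: "L J \<gamma> s s u = u" if "s \<in> J" "u \<in> carrier (V (\<gamma> s))" for s u
    using transport path that unfolding linear_transport_def by blast
  have e_carrier: "e s j \<in> carrier (V (\<gamma> s))" if "s \<in> J" "j < n" for s j
    using vector_frame.frame_carrier[OF frame] that by blast
  have H: "H t s \<in> carrier_mat n n"
    and L_frame: "\<And>j. j < n \<Longrightarrow> L J \<gamma> s t (e s j) =
      frame_comb (V (\<gamma> t)) n (e t) (\<lambda>i. H t s $$ (i, j))"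
    if "s \<in> J" "t \<in> J" for s t
    unfolding H_def
    using transport_matrix[where V = V and \<gamma> = \<gamma> and e = e and L = L and J = J and s = s and t = t,
        OF lin[OF that] frame[OF that(1)] frame[OF that(2)]] by blast+
  have H_id: "H s s = 1\<^sub>m n" if s: "s \<in> J" for s
    unfolding H_def
  proof (rule transport_matrix_eqI)
    show "vector_frame (V (\<gamma> s)) n (e s)"
      by (rule frame[OF s])
    fix j
    assume j: "j < n"
    have "L J \<gamma> s s (e s j) = frame_comb (V (\<gamma> s)) n (e s) (\<lambda>i. if i = j then 1 else 0)"
      using s j by (simp add: L_id e_carrier vector_frame.frame_comb_unit[OF frame])
    also have "\<dots> = frame_comb (V (\<gamma> s)) n (e s) (\<lambda>i. 1\<^sub>m n $$ (i, j))"
      by (rule vector_frame.frame_comb_cong[OF frame[OF s]]) (simp add: j)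
    finally show "L J \<gamma> s s (e s j) = frame_comb (V (\<gamma> s)) n (e s) (\<lambda>i. 1\<^sub>m n $$ (i, j))" .
  qed simp
  have H_comp: "H r t * H t s = H r s" if r: "r \<in> J" and s: "s \<in> J" and t: "t \<in> J" for r s t
    unfolding H_def[of r s]
  proof (rule transport_matrix_eqI[symmetric])
    show "vector_frame (V (\<gamma> r)) n (e r)"
      by (rule frame[OF r])
    show "H r t * H t s \<in> carrier_mat n n"
      using H r s t by (meson mult_carrier_mat)
    fix j
    assume j: "j < n"
    \<comment> \<open>Column \<open>j\<close> of the product is obtained by following
      \<open>e s j\<close> through the intermediate fibre at \<open>t\<close>.\<close>
    have "L J \<gamma> s r (e s j) = L J \<gamma> t r (L J \<gamma> s t (e s j))"
      using r s t j by (simp add: L_comp e_carrier)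
    also have "\<dots> = frame_comb (V (\<gamma> r)) n (e r) (\<lambda>i. \<Sum>k<n. H r t $$ (i, k) * H t s $$ (k, j))"
      unfolding L_frame[OF s t j]
      by (rule linear_map_frame_comb[OF lin[OF t r] frame[OF t] frame[OF r] L_frame[OF t r]])
    also have "\<dots> = frame_comb (V (\<gamma> r)) n (e r) (\<lambda>i. (H r t * H t s) $$ (i, j))"
      using H[OF t r] H[OF s t] j
      by (intro vector_frame.frame_comb_cong[OF frame[OF r]])
        (simp add: scalar_prod_def lessThan_atLeast0)
    finally show "L J \<gamma> s r (e s j) =
        frame_comb (V (\<gamma> r)) n (e r) (\<lambda>i. (H r t * H t s) $$ (i, j))" .
  qed
  have isometric: "(\<forall>u\<in>carrier (V (\<gamma> s)). \<forall>v\<in>carrier (V (\<gamma> s)).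
        g (\<gamma> s) u v = g (\<gamma> t) (L J \<gamma> s t u) (L J \<gamma> s t v)) \<longleftrightarrow>
      congruent_mat (H t s) (M t) = M s" if s: "s \<in> J" and t: "t \<in> J" for s t
  proof -
    \<comment> \<open>The Gram matrix of the pulled-back form in \<open>e s\<close> is that of the
      transported frame in the fibre at \<open>t\<close>, whose coordinates in \<open>e t\<close>
      are the columns of \<open>H t s\<close>.\<close>
    have "metric_matrix n (\<lambda>u v. g (\<gamma> t) (L J \<gamma> s t u) (L J \<gamma> s t v)) (e s) =
        metric_matrix n (g (\<gamma> t)) (\<lambda>j. L J \<gamma> s t (e s j))"
      by (simp add: metric_matrix_def)
    then have "transpose_mat (metric_matrix n (\<lambda>u v. g (\<gamma> t) (L J \<gamma> s t u) (L J \<gamma> s t v)) (e s)) =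
        congruent_mat (H t s) (M t)"
      unfolding M_def
      using vector_frame.transpose_metric_matrix_frame_change[OF frame[OF t] sesq[OF t] H[OF s t] L_frame[OF s t]]
      by simp
    then show ?thesis
      unfolding vector_frame.sesquilinear_eq_iff_metric_matrix_eq[OF frame[OF s] sesq[OF s]
          sesquilinear_pullback[OF lin[OF s t] sesq[OF t]]]
      by (metis M_def transpose_transpose)
  qed
  have "consistent_along V g L J \<gamma> \<longleftrightarrow> (\<forall>s\<in>J. \<forall>t\<in>J. congruent_mat (H t s) (M t) = M s)"
    by (simp add: consistent_along_def isometric)
  also have "\<dots> \<longleftrightarrow> (\<exists>F. (\<forall>s\<in>J. F s \<in> carrier_mat n n \<and> invertible_mat (F s)) \<and>
         (\<forall>s\<in>J. \<forall>t\<in>J. H t s = inverse_mat (F t) * F s) \<and> pseudo_unitary_form n J p D F)"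
    by (rule isometric_cocycle_iff_pseudo_unitary_form[OF _ _ H H_id H_comp])
      (use adapted path reducing in \<open>auto simp: adapted_frame_def path_in_def reducing_matrices_def
        M_def metric_matrix_def congruent_mat_def\<close>)
  finally show ?thesis
    by (simp add: defines_transport_matrix_def H_def conj_assoc)
qed

theorem proposition4p5:
  fixes E :: "'e topology"
    and \<pi> :: "'e \<Rightarrow> 'b"
    and B :: "'b topology"
    and V :: "'b \<Rightarrow> (complex, 'e) module"
    and n :: nat
    and g :: "'b \<Rightarrow> 'e \<Rightarrow> 'e \<Rightarrow> complex"
    and L :: "real set \<Rightarrow> (real \<Rightarrow> 'b) \<Rightarrow> real \<Rightarrow> real \<Rightarrow> 'e \<Rightarrow> 'e"
  assumes "complex_vector_bundle E \<pi> B V n"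
    and "hermitian_bundle_metric B V g"
    and "linear_transport B V L"
  shows
    "(\<forall>(p :: real set \<Rightarrow> (real \<Rightarrow> 'b) \<Rightarrow> nat)
        (e :: real set \<Rightarrow> (real \<Rightarrow> 'b) \<Rightarrow> real \<Rightarrow> nat \<Rightarrow> 'e)
        (D :: real set \<Rightarrow> (real \<Rightarrow> 'b) \<Rightarrow> real \<Rightarrow> complex mat).
        (\<forall>J \<gamma>. path_in B J \<gamma> \<longrightarrow>
           constant_signature_along V n g J \<gamma> \<and>
           adapted_frame V n g J \<gamma> (p J \<gamma>) (e J \<gamma>) \<and>
           reducing_matrices n g J \<gamma> (p J \<gamma>) (e J \<gamma>) (D J \<gamma>)) \<longrightarrow>
        ((\<forall>J \<gamma>. path_in B J \<gamma> \<longrightarrow> consistent_along V g L J \<gamma>) \<longleftrightarrow>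
         (\<forall>J \<gamma>. path_in B J \<gamma> \<longrightarrow>
            (\<exists>F. defines_transport_matrix V n L J \<gamma> (e J \<gamma>) F \<and>
                 pseudo_unitary_form n J (p J \<gamma>) (D J \<gamma>) F))))
     \<and>
     (\<forall>(J :: real set) (\<gamma> :: real \<Rightarrow> 'b) (p :: nat)
        (e :: real \<Rightarrow> nat \<Rightarrow> 'e) (D :: real \<Rightarrow> complex mat).
        path_in B J \<gamma> \<and>
        constant_signature_along V n g J \<gamma> \<and>
        adapted_frame V n g J \<gamma> p e \<and>
        reducing_matrices n g J \<gamma> p e D \<longrightarrow>
        (consistent_along V g L J \<gamma> \<longleftrightarrow>
         (\<exists>F. defines_transport_matrix V n L J \<gamma> e F \<and> pseudo_unitary_form n J p D F)))"
proof -
  note iff = consistent_along_iff_pseudo_unitary_form[OF assms]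
  show ?thesis
  \<comment> \<open>Both sides of the first claim quantify over paths, so the equivalence may be
    proved for each path with its own \<open>p\<close>, \<open>e\<close> and
    \<open>D\<close>.\<close>
  proof (intro conjI allI impI iff_allI imp_cong refl, goal_cases)
    case (1 p e D J \<gamma>)
    then show ?case
      by (intro iff) auto
  next
    case (2 J \<gamma> p e D)
    then show ?case
      by (intro iff) auto
  qed
qed

end
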